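(* Let $C_n$ be the cycle graph on $n\ge3$ vertices. Then $n(C_n)=2n$.
   Context: A word $w$ over the alphabet $V$ word-represents a graph $G=(V,E)$ if $w$ contains every letter of $V$ at least once and for all distinct $x,y\in V$, $xy\in E$ if and only if $x$ and $y$ alternate in $w$ (the subword of $w$ consisting only of occurrences of $x$ and $y$ has no two equal consecutive letters). $\ell(G)$ is the minimum length of a word that word-represents $G$, and $n(G)$ is the number of words of length $\ell(G)$ that word-represent $G$. *)

theory Defs
  imports Main
begin

type_synonym 'a graph = "'a set \<times> 'a set set"

definition simple_graph :: "'a graph \<Rightarrow> bool" where
  "simple_graph G \<longleftrightarrow>
     finite (fst G) \<and> (\<forall>e \<in> snd G. e \<subseteq> fst G \<and> card e = 2)"

definition alternate :: "'a list \<Rightarrow> 'a \<Rightarrow> 'a \<Rightarrow> bool" where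
  "alternate w x y \<longleftrightarrow> distinct_adj (filter (\<lambda>z. z = x \<or> z = y) w)"

definition word_represents :: "'a list \<Rightarrow> 'a graph \<Rightarrow> bool" where
  "word_represents w G \<longleftrightarrow>
     set w = fst G \<and>
     (\<forall>x \<in> fst G. \<forall>y \<in> fst G. x \<noteq> y \<longrightarrow> ({x, y} \<in> snd G \<longleftrightarrow> alternate w x y))"

text \<open>The minimum below is meaningful only for graphs that are represented by some word;
  for other graphs \<open>num_min_words\<close> is \<open>0\<close>.\<close>

definition min_word_length :: "'a graph \<Rightarrow> nat" where
  "min_word_length G = (LEAST k. \<exists>w. word_represents w G \<and> length w = k)"

definition num_min_words :: "'a graph \<Rightarrow> nat" where
  "num_min_words G = card {w. word_represents w G \<and> length w = min_word_length G}"

text \<open>For \<open>n < 3\<close> the following is not a cycle (for \<open>n = 1\<close> it is not even a simple graph).\<close>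

definition cycle_graph :: "nat \<Rightarrow> nat graph" where
  "cycle_graph n = ({..<n}, {{i, Suc i mod n} | i. i < n})"

lemma simple_graph_cycle_graph:
  assumes "n \<ge> 3"
  shows "simple_graph (cycle_graph n)"
proof -
  have "i \<noteq> Suc i mod n" if "i < n" for i
    using that assms by (cases "Suc i = n") auto
  then show ?thesis
    using assms by (auto simp: simple_graph_def cycle_graph_def card_2_iff)
qed

end

theory Submission
  imports Defs "HOL-Combinatorics.Multiset_Permutations"
begin

text \<open>
  Letters occurring once pairwise alternate, so for \<open>n \<ge> 4\<close> a word representing \<open>C\<^sub>n\<close> has at most two
  of them, and a word of minimum length \<open>2n - 2\<close> has exactly two, which are adjacent, while all other
  letters occur twice. Rotate the cycle so that these two are \<open>0\<close> and \<open>n - 1\<close>. Then between the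
  two copies of an inner letter \<open>x\<close> there is exactly one \<open>x - 1\<close> and one \<open>x + 1\<close>, and nothing else;
  hence the two copies are at distance 3, and up to reversal the word is
  \<open>1 0 2 1 3 2 \<dots> (n-1) (n-2)\<close>. The \<open>n\<close> rotations of this word and their reversals are distinct.
\<close>

section \<open>Alternation in terms of positions of letters\<close>

definition occ :: "'a list \<Rightarrow> 'a \<Rightarrow> nat set" where
  "occ w x = {i. i < length w \<and> w ! i = x}"

lemma card_occ: "card (occ w x) = count_list w x"
  by (simp add: occ_def count_list_eq_length_filter length_filter_conv_card) (metis (no_types, opaque_lifting))

lemma finite_occ [simp]: "finite (occ w x)"
  by (simp add: occ_def)

lemma occ_disjoint: "x \<noteq> y \<Longrightarrow> occ w x \<inter> occ w y = {}"
  by (auto simp: occ_def)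

lemma alternate_commute: "alternate w x y \<longleftrightarrow> alternate w y x"
  by (simp add: alternate_def disj_commute)

lemma alternate_rev: "alternate (rev w) x y \<longleftrightarrow> alternate w x y"
  by (simp add: alternate_def flip: rev_filter)

lemma alternate_map:
  assumes "inj_on f A" "set w \<subseteq> A" "x \<in> A" "y \<in> A"
  shows "alternate (map f w) (f x) (f y) \<longleftrightarrow> alternate w x y"
proof -
  have "filter (\<lambda>z. z = f x \<or> z = f y) (map f w) = map f (filter (\<lambda>z. z = x \<or> z = y) w)"
    unfolding filter_map o_def using assms
    by (intro arg_cong[where f = "map f"] filter_cong) (auto dest: inj_onD)
  then show ?thesis
    using assms by (simp add: alternate_def) (subst distinct_adj_map_iff, auto intro: inj_on_subset)
qed

text \<open>This is the condition that a new leading letter \<open>c\<close> adds to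
  \<open>distinct_adj\<close>. It is put on all later copies of \<open>c\<close>, not only on the
  first kept letter, to match the quantification over all pairs below.\<close>

lemma first_filter_iff_nth:
  "filter P w = [] \<or> hd (filter P w) \<noteq> c \<longleftrightarrow>
    (\<forall>j < length w. w ! j = c \<longrightarrow> P c \<longrightarrow> (\<exists>k < j. P (w ! k) \<and> w ! k \<noteq> c))"
proof (induction w)
  case (Cons d w)
  consider "d = c" | "d \<noteq> c" "P d" | "\<not> P d" "d \<noteq> c"
    by blast
  then show ?case
  proof cases
    case 1
    then show ?thesis
      using Cons by (cases "P c") (auto simp: filter_empty_conv dest: hd_in_set)
  next
    case 2
    then show ?thesis
      by (auto simp: nth_Cons' intro: exI[of _ 0])
  next
    case 3
    then show ?thesis
      using Cons by (simp add: All_less_Suc2 Ex_less_Suc2)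
  qed
qed simp

text \<open>Demanding a separating letter for every pair of equal kept letters, not just for
  neighbouring ones, costs nothing: a separator of two closest copies also separates copies further
  apart. Induction on the word; the pairs starting at the head are covered by
  \<open>first_filter_iff_nth\<close>.\<close>

lemma distinct_adj_filter_iff_nth:
  "distinct_adj (filter P w) \<longleftrightarrow>
    (\<forall>j < length w. \<forall>i < j. w ! i = w ! j \<longrightarrow> P (w ! j) \<longrightarrow>
      (\<exists>k < j. i < k \<and> P (w ! k) \<and> w ! k \<noteq> w ! j))"
proof (induction w)
  case (Cons c w)
  have eq: "distinct_adj (filter P (c # w)) \<longleftrightarrow> distinct_adj (filter P w) \<and>
      (P c \<longrightarrow> filter P w = [] \<or> hd (filter P w) \<noteq> c)"
    by (auto simp: distinct_adj_Cons)
  show ?case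
    unfolding eq Cons.IH first_filter_iff_nth
    by (simp add: All_less_Suc2 Ex_less_Suc2) auto
qed simp

lemma alternate_iff_nth:
  "alternate w x y \<longleftrightarrow>
    (\<forall>j < length w. \<forall>i < j. w ! i = w ! j \<longrightarrow> w ! j \<in> {x, y} \<longrightarrow>
      (\<exists>k < j. i < k \<and> w ! k \<in> {x, y} \<and> w ! k \<noteq> w ! j))"
  by (simp add: alternate_def distinct_adj_filter_iff_nth)

lemma alternate_between:
  assumes "alternate w x y" "i < j" "j < length w" "w ! i = x" "w ! j = x"
  shows "\<exists>k. i < k \<and> k < j \<and> w ! k = y"
  using assms unfolding alternate_iff_nth by fastforce

lemma occ_eq_if_card_le_2:
  assumes "card (occ w y) \<le> 2" "i \<in> occ w y" "j \<in> occ w y" "i \<noteq> j"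
  shows "occ w y = {i, j}"
  using assms by (intro card_seteq[symmetric]) auto

text \<open>Some \<open>y\<close> must separate the two copies of \<open>x\<close>, and two such
  \<open>y\<close> would need a third \<open>x\<close> between them. Conversely, if \<open>y\<close>
  has a second copy, it lies outside the interval from \<open>a\<close> to \<open>b\<close>, so
  \<open>a\<close> or \<open>b\<close> separates it from the copy inside.\<close>

lemma alternate_iff_ex1:
  assumes ab: "occ w x = {a, b}" "a < b" and y: "card (occ w y) \<le> 2" and "x \<noteq> y"
  shows "alternate w x y \<longleftrightarrow> (\<exists>!k. a < k \<and> k < b \<and> w ! k = y)"
proof
  have len: "b < length w" and wab: "w ! a = x" "w ! b = x"
    using ab(1) by (auto simp: occ_def)
  have x: "i = a \<or> i = b" if "w ! i = x" "i < length w" for i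
    using that ab(1) by (auto simp: occ_def)
  {
    assume alt: "alternate w x y"
    obtain k where k: "a < k" "k < b" "w ! k = y"
      using alternate_between[OF alt] ab(2) len wab by blast
    have False if "a < i" "i < j" "j < b" "w ! i = y" "w ! j = y" for i j
    proof -
      have "alternate w y x"
        using alt by (subst alternate_commute)
      moreover have "j < length w"
        using \<open>j < b\<close> len by simp
      ultimately obtain l where l: "i < l" "l < j" "w ! l = x"
        using alternate_between[OF _ \<open>i < j\<close>] \<open>w ! i = y\<close> \<open>w ! j = y\<close> by metis
      then have "l = a \<or> l = b"
        using x \<open>j < length w\<close> by simp
      then show False
        using l \<open>a < i\<close> \<open>j < b\<close> by linarith
    qed
    then show "\<exists>!k. a < k \<and> k < b \<and> w ! k = y"
      using k by (metis nat_neq_iff)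
  }
  assume "\<exists>!k. a < k \<and> k < b \<and> w ! k = y"
  then obtain k where k: "a < k" "k < b" "w ! k = y"
    and uniq: "\<And>l. a < l \<Longrightarrow> l < b \<Longrightarrow> w ! l = y \<Longrightarrow> l = k"
    by blast
  have "k \<in> occ w y"
    using k len by (simp add: occ_def)
  show "alternate w x y"
    unfolding alternate_iff_nth
  proof (intro allI impI)
    fix i j assume ij: "j < length w" "i < j" "w ! i = w ! j" "w ! j \<in> {x, y}"
    consider "w ! j = x" | "w ! j = y"
      using ij by blast
    then show "\<exists>k < j. i < k \<and> w ! k \<in> {x, y} \<and> w ! k \<noteq> w ! j"
    proof cases
      case 1
      then have "i = a" "j = b"
        using x[of i] x[of j] ij ab(2) by auto
      then show ?thesis
        using k 1 \<open>x \<noteq> y\<close> by auto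
    next
      case 2
      then have "occ w y = {i, j}"
        using ij y by (intro occ_eq_if_card_le_2) (auto simp: occ_def)
      then consider "k = i" | "k = j"
        using \<open>k \<in> occ w y\<close> by blast
      then show ?thesis
      proof cases
        case 1
        then have "b < j"
          using uniq[of j] ij k 2 wab \<open>x \<noteq> y\<close> by (metis nat_neq_iff order.strict_trans)
        then show ?thesis
          using k 1 2 wab \<open>x \<noteq> y\<close> by auto
      next
        case j: 2
        then have "i < a"
          using uniq[of i] ij k 2 wab \<open>x \<noteq> y\<close> by (metis nat_neq_iff order.strict_trans)
        then show ?thesis
          using k j 2 wab \<open>x \<noteq> y\<close> by auto
      qed
    qed
  qed
qed

lemma count_list_le_1_if_distinct: "distinct w \<Longrightarrow> count_list w x \<le> 1"
  by (induction w) auto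

text \<open>Neither letter has two positions to separate, so the criterion
  \<open>alternate_iff_nth\<close> holds vacuously.\<close>

lemma alternate_if_count_le_1:
  assumes "count_list w x \<le> 1" "count_list w y \<le> 1"
  shows "alternate w x y"
proof -
  have "i = j" if "i < length w" "j < length w" "w ! i = w ! j" "w ! j \<in> {x, y}" for i j
  proof -
    have "card (occ w (w ! j)) \<le> 1"
      using that assms by (auto simp: card_occ)
    moreover have "i \<in> occ w (w ! j)" "j \<in> occ w (w ! j)"
      using that by (auto simp: occ_def)
    ultimately show ?thesis
      by (auto simp: card_le_Suc0_iff_eq)
  qed
  then show ?thesis
    unfolding alternate_iff_nth by (metis less_irrefl order.strict_trans)
qed

section \<open>Reversal and relabelling of representing words\<close>

lemma word_represents_rev: "word_represents (rev w) G \<longleftrightarrow> word_represents w G"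
  by (simp add: word_represents_def alternate_rev)

lemma word_represents_map:
  assumes "word_represents w G" and f: "bij_betw f (fst G) (fst G)"
    and edges: "\<And>x y. x \<in> fst G \<Longrightarrow> y \<in> fst G \<Longrightarrow> {f x, f y} \<in> snd G \<longleftrightarrow> {x, y} \<in> snd G"
  shows "word_represents (map f w) G"
  unfolding word_represents_def
proof (intro conjI ballI impI)
  have w: "set w = fst G"
    "\<And>x y. x \<in> fst G \<Longrightarrow> y \<in> fst G \<Longrightarrow> x \<noteq> y \<Longrightarrow> {x, y} \<in> snd G \<longleftrightarrow> alternate w x y"
    using assms(1) by (auto simp: word_represents_def)
  have im: "f ` fst G = fst G" and inj: "inj_on f (fst G)"
    using f by (auto simp: bij_betw_def)
  show "set (map f w) = fst G"
    using w im by simp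
  fix x y assume "x \<in> fst G" "y \<in> fst G" "x \<noteq> y"
  then obtain x' y' where "x' \<in> fst G" "y' \<in> fst G" "x = f x'" "y = f y'" "x' \<noteq> y'"
    using im by (metis imageE)
  then show "{x, y} \<in> snd G \<longleftrightarrow> alternate (map f w) x y"
    using w edges alternate_map[OF inj, of w x' y'] by simp
qed

lemma occ_rev: "occ (rev w) x = (\<lambda>i. length w - Suc i) ` occ w x"
proof (intro equalityI subsetI)
  fix i assume "i \<in> occ (rev w) x"
  then show "i \<in> (\<lambda>i. length w - Suc i) ` occ w x"
    by (intro image_eqI[of _ _ "length w - Suc i"]) (auto simp: occ_def rev_nth)
qed (auto simp: occ_def rev_nth)

lemma card_2_less_pairE:
  assumes "card (A :: nat set) = 2"
  obtains a b where "A = {a, b}" "a < b"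
proof -
  obtain a b where ab: "A = {a, b}" "a \<noteq> b"
    using assms by (auto simp: card_2_iff)
  then show ?thesis
    using that[of a b] that[of b a] by (cases "a < b") auto
qed

section \<open>Edges and rotations of the cycle\<close>

lemma fst_cycle_graph [simp]: "fst (cycle_graph n) = {..<n}"
  by (simp add: cycle_graph_def)

lemma cycle_edge_iff:
  assumes "x < n" "y < n"
  shows "{x, y} \<in> snd (cycle_graph n) \<longleftrightarrow> y = Suc x mod n \<or> x = Suc y mod n"
  using assms by (auto simp: cycle_graph_def doubleton_eq_iff)

lemma cycle_edge_less_iff:
  assumes "x < y" "y < n"
  shows "{x, y} \<in> snd (cycle_graph n) \<longleftrightarrow> y = Suc x \<or> (x = 0 \<and> Suc y = n)"
  using assms by (subst cycle_edge_iff) (auto simp: mod_Suc)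

text \<open>Used to bound the number of letters that occur only once. It fails for
  \<open>n = 3\<close>, which is why the triangle is treated separately.\<close>

lemma cycle_triangle_free:
  assumes "n \<ge> 4" "x < n" "y < n" "z < n"
    and "{x, y} \<in> snd (cycle_graph n)" "{y, z} \<in> snd (cycle_graph n)"
      "{x, z} \<in> snd (cycle_graph n)"
  shows False
  using assms by (auto simp: cycle_edge_iff mod_Suc split: if_splits)

definition rot :: "nat \<Rightarrow> nat \<Rightarrow> nat \<Rightarrow> nat" where
  "rot n k x = (x + k) mod n"

lemma rot_less: "0 < n \<Longrightarrow> rot n k x < n"
  by (simp add: rot_def)

lemma rot_rot_inverse:
  assumes "x < n" "k \<le> n"
  shows "rot n k (rot n (n - k) x) = x" "rot n (n - k) (rot n k x) = x"
  using assms by (simp_all add: rot_def mod_simps add.assoc del: add_diff_assoc)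

lemma bij_betw_rot:
  assumes "k \<le> n"
  shows "bij_betw (rot n k) {..<n} {..<n}"
  using assms by (intro bij_betw_byWitness[where f' = "rot n (n - k)"])
    (auto simp: rot_rot_inverse intro!: rot_less)

lemma rot_eq_iff: "k \<le> n \<Longrightarrow> x < n \<Longrightarrow> y < n \<Longrightarrow> rot n k x = rot n k y \<longleftrightarrow> x = y"
  by (metis rot_rot_inverse(2))

lemma Suc_rot: "Suc (rot n k x) mod n = rot n k (Suc x mod n)"
  by (simp add: rot_def mod_simps)

lemma word_represents_rot:
  assumes "word_represents w (cycle_graph n)" "k \<le> n"
  shows "word_represents (map (rot n k) w) (cycle_graph n)"
proof (rule word_represents_map[OF assms(1)])
  show "bij_betw (rot n k) (fst (cycle_graph n)) (fst (cycle_graph n))"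
    using bij_betw_rot assms(2) by simp
  fix x y assume "x \<in> fst (cycle_graph n)" "y \<in> fst (cycle_graph n)"
  then show "{rot n k x, rot n k y} \<in> snd (cycle_graph n) \<longleftrightarrow> {x, y} \<in> snd (cycle_graph n)"
    using assms(2) by (simp add: cycle_edge_iff rot_less Suc_rot rot_eq_iff)
qed

section \<open>The zigzag word represents the cycle\<close>

text \<open>This is \<open>1 0 2 1 3 2 ... (n-1) (n-2)\<close>, seen as two interleaved increasing
  runs: \<open>1\<close> to \<open>n - 1\<close> on even positions and \<open>0\<close> to
  \<open>n - 2\<close> on odd ones. The closed form lets positions be found by arithmetic.\<close>

definition zigzag :: "nat \<Rightarrow> nat list" where
  "zigzag n = map (\<lambda>j. if even j then Suc (j div 2) else j div 2) [0..<2 * n - 2]"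

lemma length_zigzag [simp]: "length (zigzag n) = 2 * n - 2"
  by (simp add: zigzag_def)

lemma nth_zigzag: "j < 2 * n - 2 \<Longrightarrow> zigzag n ! j = (if even j then Suc (j div 2) else j div 2)"
  by (simp add: zigzag_def)

lemma occ_zigzag_inner:
  assumes "0 < x" "Suc x < n"
  shows "occ (zigzag n) x = {2 * x - 2, 2 * x + 1}"
  using assms by (auto simp: occ_def nth_zigzag split: if_splits elim!: evenE oddE)

lemma occ_zigzag_ends:
  assumes "n \<ge> 2"
  shows "occ (zigzag n) 0 = {1}" "occ (zigzag n) (n - 1) = {2 * n - 4}"
  using assms by (auto simp: occ_def nth_zigzag split: if_splits elim!: evenE oddE)

text \<open>The bounds are the two positions of the inner letter \<open>x\<close>. Only
  \<open>2 * x - 1\<close> and \<open>2 * x\<close> lie between them, and these hold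
  \<open>x - 1\<close> and \<open>Suc x\<close>.\<close>

lemma zigzag_ex1_iff:
  assumes "0 < x" "Suc x < n"
  shows "(\<exists>!k. 2 * x - 2 < k \<and> k < 2 * x + 1 \<and> zigzag n ! k = y) \<longleftrightarrow> y = x - 1 \<or> y = Suc x"
proof -
  have "zigzag n ! (2 * x - 1) = x - 1" "zigzag n ! (2 * x) = Suc x"
    using assms by (auto simp: nth_zigzag)
  moreover have "2 * x - 2 < k \<and> k < 2 * x + 1 \<longleftrightarrow> k = 2 * x - 1 \<or> k = 2 * x" for k
    using assms by auto
  ultimately have *: "2 * x - 2 < k \<and> k < 2 * x + 1 \<and> zigzag n ! k = y \<longleftrightarrow>
      (k = 2 * x - 1 \<and> y = x - 1) \<or> (k = 2 * x \<and> y = Suc x)" for k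
    by (cases "k = 2 * x - 1"; cases "k = 2 * x") auto
  show ?thesis
    unfolding * by (cases "y = x - 1"; cases "y = Suc x") (simp_all add: Ex1_def)
qed

lemma card_occ_zigzag_le:
  assumes "n \<ge> 2" "x < n"
  shows "0 < card (occ (zigzag n) x)" "card (occ (zigzag n) x) \<le> 2"
proof -
  consider "x = 0" | "x = n - 1" | "0 < x" "Suc x < n"
    using assms by linarith
  then have "0 < card (occ (zigzag n) x) \<and> card (occ (zigzag n) x) \<le> 2"
    by cases (use assms in \<open>auto simp: occ_zigzag_inner occ_zigzag_ends simp del: One_nat_def\<close>)
  then show "0 < card (occ (zigzag n) x)" "card (occ (zigzag n) x) \<le> 2"
    by auto
qed

lemma alternate_zigzag_iff:
  assumes "0 < x" "Suc x < n" "y < n" "x \<noteq> y"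
  shows "alternate (zigzag n) x y \<longleftrightarrow> y = x - 1 \<or> y = Suc x"
proof (rule trans[OF alternate_iff_ex1 zigzag_ex1_iff])
  show "card (occ (zigzag n) y) \<le> 2"
    using assms by (intro card_occ_zigzag_le) auto
qed (use assms in \<open>auto simp: occ_zigzag_inner\<close>)

text \<open>A pair containing an inner letter is decided by \<open>alternate_zigzag_iff\<close>. The
  only other pair is \<open>0\<close> and \<open>n - 1\<close>: both occur once, hence alternate,
  and they are joined by the closing edge.\<close>

lemma word_represents_zigzag:
  assumes "n \<ge> 3"
  shows "word_represents (zigzag n) (cycle_graph n)"
proof -
  have "x \<in> set (zigzag n)" if "x < n" for x
    using card_occ_zigzag_le(1)[of n x] assms that by (cases "x \<in> set (zigzag n)") (auto simp: card_occ)
  moreover have "set (zigzag n) \<subseteq> {..<n}"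
    by (auto simp: zigzag_def elim!: evenE oddE)
  ultimately have set: "set (zigzag n) = {..<n}"
    by blast
  have *: "{x, y} \<in> snd (cycle_graph n) \<longleftrightarrow> alternate (zigzag n) x y" if xy: "x < y" "y < n" for x y
  proof -
    consider "x = 0" "Suc y = n" | "x = 0" "Suc y < n" | "0 < x"
      using xy by linarith
    then show ?thesis
    proof cases
      case 1
      then have "y = n - 1"
        by simp
      then have "alternate (zigzag n) x y"
        using 1 assms occ_zigzag_ends[of n]
        by (intro alternate_if_count_le_1) (simp_all flip: card_occ)
      then show ?thesis
        using 1 that by (simp add: cycle_edge_less_iff)
    next
      case 2
      have "alternate (zigzag n) y x \<longleftrightarrow> x = y - 1 \<or> x = Suc y"
        using 2 that by (intro alternate_zigzag_iff) auto
      then show ?thesis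
        using 2 that alternate_commute[of "zigzag n" x y] by (auto simp: cycle_edge_less_iff)
    next
      case 3
      have "alternate (zigzag n) x y \<longleftrightarrow> y = x - 1 \<or> y = Suc x"
        using 3 that by (intro alternate_zigzag_iff) auto
      then show ?thesis
        using 3 that by (auto simp: cycle_edge_less_iff)
    qed
  qed
  show ?thesis
    unfolding word_represents_def
  proof (intro conjI ballI impI)
    fix x y assume "x \<in> fst (cycle_graph n)" "y \<in> fst (cycle_graph n)" "x \<noteq> y"
    then have "x < y \<and> y < n \<or> y < x \<and> x < n"
      by auto
    then show "{x, y} \<in> snd (cycle_graph n) \<longleftrightarrow> alternate (zigzag n) x y"
      using *[of x y] *[of y x] alternate_commute[of "zigzag n" x y] insert_commute[of x y "{}"]
      by metis
  qed (simp add: set)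
qed

section \<open>Minimum length and letter multiplicities\<close>

text \<open>The set \<open>S\<close> of letters occurring once is a clique, so it has at most two
  elements, and all other letters occur at least twice. Summing multiplicities gives
  \<open>2 * n \<le> length w + card S\<close>; the second claim is the case of equality.\<close>

lemma cycle_word_multiplicities:
  assumes n: "n \<ge> 4" and w: "word_represents w (cycle_graph n)"
  shows "length w \<ge> 2 * n - 2"
    and "length w = 2 * n - 2 \<Longrightarrow>
      \<exists>u v. v = Suc u mod n \<and> u < n \<and> count_list w u = 1 \<and> count_list w v = 1 \<and>
        (\<forall>x < n. x \<noteq> u \<longrightarrow> x \<noteq> v \<longrightarrow> count_list w x = 2)"
proof -
  define S where "S = {x \<in> {..<n}. count_list w x = 1}"
  have set: "set w = {..<n}"
    using w by (simp add: word_represents_def)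
  have edge: "{x, y} \<in> snd (cycle_graph n)" if "x \<in> S" "y \<in> S" "x \<noteq> y" for x y
    using that w alternate_if_count_le_1[of w x y] by (auto simp: S_def word_represents_def)
  have pos: "count_list w x > 0" if "x < n" for x
    using that set by (metis count_list_0_iff gr0I lessThan_iff)
  have card: "card S \<le> 2"
  proof (rule ccontr)
    assume "\<not> card S \<le> 2"
    then obtain T where "T \<subseteq> S" "card T = 3"
      using obtain_subset_with_card_n[of 3 S] by auto
    then obtain x y z where "{x, y, z} \<subseteq> S" "x \<noteq> y" "y \<noteq> z" "x \<noteq> z"
      by (auto simp: card_3_iff)
    then show False
      using cycle_triangle_free[OF n, of x y z] edge by (auto simp: S_def)
  qed
  \<comment> \<open>The bonus for \<open>S\<close> lifts every letter to weight at least 2, so a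
    single termwise comparison yields both the bound and its equality case.\<close>
  define f where "f x = count_list w x + (if x \<in> S then 1 else 0)" for x
  have f2: "f x \<ge> 2" if "x < n" for x
    using that pos[of x] by (auto simp: f_def S_def)
  have "(\<Sum>x<n. if x \<in> S then 1 else 0) = card S"
    by (simp add: sum.If_cases S_def Int_def)
  then have sum_f: "(\<Sum>x<n. f x) = length w + card S"
    using set by (simp add: f_def sum.distrib sum_count_set)
  have "(\<Sum>x<n. 2) \<le> (\<Sum>x<n. f x)"
    by (intro sum_mono f2) simp
  then have ge: "2 * n \<le> length w + card S"
    by (simp add: sum_f)
  then show "length w \<ge> 2 * n - 2"
    using card by linarith
  assume len: "length w = 2 * n - 2"
  then have "card S = 2"
    using ge card n by linarith
  then obtain u v where uv: "S = {u, v}" "u \<noteq> v"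
    by (auto simp: card_2_iff)
  \<comment> \<open>Equal sums of termwise comparable weights force every weight to be exactly
    2.\<close>
  have "(\<Sum>x<n. 2) = (\<Sum>x<n. f x)"
    using len \<open>card S = 2\<close> n by (simp add: sum_f)
  then have "f x = 2" if "x < n" for x
    using sum_mono_inv[of "\<lambda>_. 2" "{..<n}" f x] f2 that by auto
  then have two: "count_list w x = 2" if "x < n" "x \<notin> S" for x
    using that by (metis f_def add.right_neutral)
  have "v = Suc u mod n \<or> u = Suc v mod n"
    using edge[of u v] uv by (subst (asm) cycle_edge_iff) (auto simp: S_def)
  moreover have "u < n" "v < n" "count_list w u = 1" "count_list w v = 1"
    using uv by (auto simp: S_def)
  ultimately show "\<exists>u v. v = Suc u mod n \<and> u < n \<and> count_list w u = 1 \<and> count_list w v = 1 \<and>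
        (\<forall>x < n. x \<noteq> u \<longrightarrow> x \<noteq> v \<longrightarrow> count_list w x = 2)"
    using two uv by blast
qed

section \<open>Uniqueness of the normalized word up to reversal\<close>

text \<open>The situation after a rotation that moves the two single letters to the closing edge.
  The letters occurring twice then form the path from \<open>1\<close> to \<open>n - 2\<close>, with
  no wrap-around. The assumptions are invariant under reversal.\<close>

locale cycle_word =
  fixes n :: nat and w :: "nat list"
  assumes n: "n \<ge> 4"
    and rep: "word_represents w (cycle_graph n)"
    and count_ends: "count_list w 0 = 1" "count_list w (n - 1) = 1"
    and count_inner: "\<And>x. 0 < x \<Longrightarrow> Suc x < n \<Longrightarrow> count_list w x = 2"
begin

lemma set_w: "set w = {..<n}"
  using rep by (simp add: word_represents_def)

lemma card_occ_le: "x < n \<Longrightarrow> card (occ w x) \<le> 2"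
  using count_ends count_inner[of x] unfolding card_occ
  by (cases "x = 0"; cases "x = n - 1") auto

lemma length_w: "length w = 2 * n - 2"
proof -
  have eq: "{..<n} = insert 0 (insert (n - 1) {1..<n - 1})"
    using n by auto
  have "(\<Sum>x = 1..<n - 1. count_list w x) = (\<Sum>x = 1..<n - 1. 2)"
    by (intro sum.cong) (auto intro!: count_inner)
  moreover have "(\<Sum>x<n. count_list w x) = 2 + (\<Sum>x = 1..<n - 1. count_list w x)"
    using n count_ends unfolding eq by auto
  ultimately show ?thesis
    using sum_count_set[of w "{..<n}"] set_w n by simp
qed

lemma alternate_iff: "x < y \<Longrightarrow> y < n \<Longrightarrow> alternate w x y \<longleftrightarrow> y = Suc x \<or> (x = 0 \<and> Suc y = n)"
  using rep by (subst cycle_edge_less_iff[symmetric]) (auto simp: word_represents_def)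

lemma alternate_Suc: "Suc x < n \<Longrightarrow> alternate w x (Suc x)" "Suc x < n \<Longrightarrow> alternate w (Suc x) x"
  using alternate_iff[of x "Suc x"] alternate_commute[of w "Suc x" x] by blast+

lemma rev_cycle_word: "cycle_word n (rev w)"
  using n rep count_ends count_inner by unfold_locales (auto simp: word_represents_rev)

text \<open>A nonneighbour of \<open>x\<close> occurs between the two copies of \<open>x\<close> either never or with all its
  copies; the latter property spreads along the path towards one of the letters \<open>0\<close>, \<open>n - 1\<close>,
  which occur only once.\<close>

lemma not_between:
  assumes x: "0 < x" "Suc x < n" "occ w x = {a, b}" "a < b"
    and y: "y < n" "y \<notin> {x - 1, x, Suc x}"
  shows "\<not> (\<exists>k. a < k \<and> k < b \<and> w ! k = y)"
proof -
  define between where "between y \<longleftrightarrow> (\<exists>k. a < k \<and> k < b \<and> w ! k = y)" for y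
  have len: "b < length w"
    using x(3) by (auto simp: occ_def)
  have alt_x: "\<not> (\<exists>!k. a < k \<and> k < b \<and> w ! k = y)" if "y < n" "y \<notin> {x - 1, x, Suc x}" for y
  proof -
    have "\<not> alternate w x y"
      using that x(1,2) alternate_iff[of x y] alternate_iff[of y x] alternate_commute[of w x y]
      by (cases "x < y") auto
    then show ?thesis
      using alternate_iff_ex1[OF x(3,4) card_occ_le] that by auto
  qed
  have ends: "\<not> between y" if "y = 0 \<or> y = n - 1" "y \<notin> {x - 1, x, Suc x}" for y
  proof
    assume "between y"
    then obtain k where k: "a < k" "k < b" "w ! k = y"
      by (auto simp: between_def)
    have "card (occ w y) \<le> 1"
      using that count_ends by (auto simp: card_occ)
    then have "l = k" if "a < l" "l < b" "w ! l = y" for l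
      using k that len by (auto simp: card_le_Suc0_iff_eq occ_def)
    then have "\<exists>!k. a < k \<and> k < b \<and> w ! k = y"
      using k by blast
    moreover have "y < n"
      using that(1) n by auto
    ultimately show False
      using alt_x that(2) by blast
  qed
  have between_step: "\<not> between y"
    if y: "0 < y" "Suc y < n" "y \<notin> {x - 1, x, Suc x}"
      and z: "\<not> between z" "alternate w y z" for y z
  proof
    assume "between y"
    then obtain k where k: "a < k" "k < b" "w ! k = y"
      by (auto simp: between_def)
    then obtain l where l: "a < l" "l < b" "w ! l = y" "l \<noteq> k"
      using alt_x[of y] y by auto
    have "between z" if "a < k" "k < l" "l < b" "w ! k = y" "w ! l = y" for k l
      using alternate_between[OF z(2), of k l] that len
      unfolding between_def by (meson order.strict_trans)
    then show False
      using k l z(1) by (metis nat_neq_iff)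
  qed
  have "\<not> between y"
  \<comment> \<open>On each side of \<open>x\<close> the induction starts at the end letter,
    \<open>0\<close> or \<open>n - 1\<close>, and moves towards \<open>x\<close> without reaching
    its neighbours.\<close>
  proof (cases "y < x")
    case True
    then have "Suc y < x"
      using y by auto
    then show ?thesis
    proof (induction y)
      case 0
      then show ?case
        by (intro ends) auto
    next
      case (Suc y)
      then have "\<not> between y"
        by simp
      then show ?case
        by (rule between_step[rotated 3]) (use Suc.prems x in \<open>auto intro: alternate_Suc\<close>)
    qed
  next
    case False
    then have "y \<le> n - 1" "Suc (Suc x) \<le> y"
      using y by auto
    then show ?thesis
    proof (induction y rule: inc_induct)
      case base
      then show ?case
        using x by (intro ends) auto
    next
      case (step y)
      then have "\<not> between (Suc y)"
        by simp
      then show ?case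
        by (rule between_step[rotated 3]) (use step x in \<open>auto intro: alternate_Suc\<close>)
    qed
  qed
  then show ?thesis
    by (simp add: between_def)
qed

text \<open>Nonneighbours are excluded by \<open>not_between\<close>, and each neighbour appears
  exactly once between the copies of \<open>x\<close>. So two positions lie in between, which gives
  the distance 3. The order of the neighbours is left open; it determines the direction of the
  zigzag.\<close>

lemma window:
  assumes x: "0 < x" "Suc x < n"
  shows "\<exists>a. occ w x = {a, a + 3} \<and> a + 3 < length w \<and>
    {w ! (a + 1), w ! (a + 2)} = {x - 1, Suc x}"
proof -
  have "card (occ w x) = 2"
    using x count_inner by (simp add: card_occ)
  then obtain a b where ab: "occ w x = {a, b}" "a < b"
    by (rule card_2_less_pairE)
  have len: "b < length w"
    using ab by (auto simp: occ_def)
  have ex1: "\<exists>!k. a < k \<and> k < b \<and> w ! k = y" if "y = x - 1 \<or> y = Suc x" for y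
  proof -
    have "alternate w x y"
      using that x alternate_iff[of "x - 1" x] alternate_iff[of x "Suc x"]
        alternate_commute[of w x "x - 1"] by auto
    moreover have "y < n" "x \<noteq> y"
      using that x by auto
    ultimately show ?thesis
      using alternate_iff_ex1[OF ab card_occ_le] by blast
  qed
  obtain k where k: "a < k" "k < b" "w ! k = x - 1"
    and k_unique: "\<And>l. a < l \<Longrightarrow> l < b \<Longrightarrow> w ! l = x - 1 \<Longrightarrow> l = k"
    using ex1[of "x - 1"] by blast
  obtain l where l: "a < l" "l < b" "w ! l = Suc x"
    and l_unique: "\<And>k. a < k \<Longrightarrow> k < b \<Longrightarrow> w ! k = Suc x \<Longrightarrow> k = l"
    using ex1[of "Suc x"] by blast
  have "k \<noteq> l"
    using k l by auto
  have "i \<in> {k, l}" if "a < i" "i < b" for i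
  proof -
    have "i \<notin> occ w x"
      using that ab by auto
    then have "w ! i \<noteq> x"
      using that len by (auto simp: occ_def)
    moreover have "w ! i < n"
      using that len set_w nth_mem[of i w] by auto
    ultimately have "w ! i = x - 1 \<or> w ! i = Suc x"
      using not_between[OF x ab, of "w ! i"] that by blast
    then show ?thesis
      using k_unique l_unique that by auto
  qed
  then have "{a<..<b} \<subseteq> {k, l}"
    by (meson greaterThanLessThan_iff subsetI)
  moreover have "{k, l} \<subseteq> {a<..<b}"
    using k l by simp
  ultimately have eq: "{a<..<b} = {k, l}"
    by blast
  then have "b - Suc a = 2"
    using \<open>k \<noteq> l\<close> card_greaterThanLessThan[of a b] by simp
  then have b: "b = a + 3"
    by simp
  then have "{k, l} = {a + 1, a + 2}"
    unfolding eq[symmetric] by auto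
  then have "{w ! (a + 1), w ! (a + 2)} = {x - 1, Suc x}"
    using k l by (auto simp: doubleton_eq_iff)
  then show ?thesis
    using ab len b by auto
qed

lemma consecutive_windows:
  assumes x: "0 < x" "Suc (Suc x) < n" and occ: "occ w x = {a, a + 3}"
  shows "occ w (Suc x) = {a + 2, a + 5} \<or> (\<exists>c. a = c + 2 \<and> occ w (Suc x) = {c, c + 3})"
proof -
  obtain a' where a': "occ w x = {a', a' + 3}" "a' + 3 < length w"
    "{w ! (a' + 1), w ! (a' + 2)} = {x - 1, Suc x}"
    using window[of x] x Suc_lessD by blast
  have "a' = a"
    using a' occ by (auto simp: doubleton_eq_iff)
  note a' = a'[unfolded this]
  obtain c where c: "occ w (Suc x) = {c, c + 3}" "c + 3 < length w"
    "{w ! (c + 1), w ! (c + 2)} = {x, Suc (Suc x)}"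
    using window[of "Suc x"] x by auto
  \<comment> \<open>\<open>Suc x\<close> fills one inner place of the window of \<open>x\<close> and
    \<open>x - 1\<close> the other. Since \<open>x - 1\<close> cannot lie inside the window of
    \<open>Suc x\<close>, that window must extend away from it, to the right or to the left.\<close>
  have "a + 1 \<in> occ w (Suc x) \<and> w ! (a + 2) = x - 1 \<or>
      a + 2 \<in> occ w (Suc x) \<and> w ! (a + 1) = x - 1"
    using a' by (auto simp: occ_def doubleton_eq_iff)
  moreover have "w ! (c + 1) \<noteq> x - 1" "w ! (c + 2) \<noteq> x - 1"
    using c(3) x by (auto simp: doubleton_eq_iff)
  ultimately have "c = a + 2 \<or> a = c + 2"
    unfolding c(1) by (auto simp: numeral_eq_Suc)
  then show ?thesis
    using c(1) by auto
qed

text \<open>Once the windows move right from \<open>1\<close> to \<open>2\<close>, they keep moving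
  right by 2. The length then fixes the starting point, and the windows of \<open>1\<close> and
  \<open>n - 2\<close> give the positions of the end letters.\<close>

lemma zigzag_if_increasing:
  assumes "occ w 1 = {a, a + 3}" "occ w 2 = {a + 2, a + 5}"
  shows "w = zigzag n"
proof -
  \<comment> \<open>Two consecutive letters are carried along, because excluding a turn back needs
    the letter before the current one.\<close>
  have "occ w (Suc m) = {a + 2 * m, a + 2 * m + 3} \<and>
      occ w (Suc (Suc m)) = {a + 2 * m + 2, a + 2 * m + 5}" if "m + 3 < n" for m
    using that
  proof (induction m)
    case 0
    then show ?case
      using assms by (simp add: numeral_2_eq_2)
  next
    case (Suc m)
    then have IH: "occ w (Suc m) = {a + 2 * m, a + 2 * m + 3}"
      "occ w (Suc (Suc m)) = {a + 2 * m + 2, a + 2 * m + 2 + 3}"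
      by (auto simp: add.assoc)
    \<comment> \<open>Turning back would place this letter on the positions of
      \<open>Suc m\<close>.\<close>
    have "occ w (Suc (Suc (Suc m))) \<noteq> {a + 2 * m, a + 2 * m + 3}"
      using occ_disjoint[of "Suc m" "Suc (Suc (Suc m))" w] by (simp add: IH(1)) blast
    moreover have "occ w (Suc (Suc (Suc m))) = {a + 2 * m + 2 + 2, a + 2 * m + 2 + 5} \<or>
        (\<exists>c. a + 2 * m + 2 = c + 2 \<and> occ w (Suc (Suc (Suc m))) = {c, c + 3})"
      by (rule consecutive_windows[OF _ _ IH(2)]) (use Suc.prems in auto)
    ultimately have "occ w (Suc (Suc (Suc m))) = {a + 2 * m + 2 + 2, a + 2 * m + 2 + 5}"
      by (elim disjE exE conjE) simp_all
    then show ?case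
      using IH(2) by (simp add: add.assoc)
  qed note occ_pair = this
  have occ_a: "occ w (Suc m) = {a + 2 * m, a + 2 * m + 3}" if "m + 2 < n" for m
  proof (cases m)
    case 0
    then show ?thesis
      using assms(1) by simp
  next
    case (Suc l)
    then show ?thesis
      using occ_pair[of l] that by (simp add: algebra_simps)
  qed
  \<comment> \<open>The second copy of the last inner letter \<open>n - 2\<close> is at
    \<open>a + 2 * n - 3\<close>; it fits into length \<open>2 * n - 2\<close> only if
    \<open>a = 0\<close>.\<close>
  have "a + 2 * (n - 3) + 3 \<in> occ w (Suc (n - 3))"
    using occ_a[of "n - 3"] n by simp
  then have "a + 2 * (n - 3) + 3 < 2 * n - 2"
    by (simp add: occ_def length_w)
  then have "a = 0"
    using n by linarith
  note occ_0 = occ_a[unfolded this add_0]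
  have even: "w ! (2 * m) = Suc m" and odd: "w ! (2 * m + 3) = Suc m" if "m + 2 < n" for m
    using occ_0[OF that] by (auto simp: occ_def)
  have window': "{w ! (2 * m + 1), w ! (2 * m + 2)} = {m, Suc (Suc m)}" if m: "m + 2 < n" for m
  proof -
    obtain c where "occ w (Suc m) = {c, c + 3}" "{w ! (c + 1), w ! (c + 2)} = {m, Suc (Suc m)}"
      using window[of "Suc m"] m by auto
    moreover from this have "c = 2 * m"
      using occ_0[OF m] by (auto simp: doubleton_eq_iff)
    ultimately show ?thesis
      by simp
  qed
  \<comment> \<open>The window of \<open>1\<close> contains \<open>0\<close> and \<open>2\<close>,
    and position 2 is already taken by \<open>2\<close>. The position of \<open>n - 1\<close> is
    found likewise from the window of \<open>n - 2\<close>.\<close>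
  have first: "w ! 1 = 0"
    using window'[of 0] even[of 1] n by (auto simp: doubleton_eq_iff numeral_2_eq_2)
  have last: "w ! (2 * (n - 2)) = n - 1"
  proof -
    obtain m where "n = m + 4"
      using n by (metis add.commute le_Suc_ex)
    then show ?thesis
      using window'[of "m + 1"] odd[of m] by (auto simp: doubleton_eq_iff numeral_eq_Suc)
  qed
  show ?thesis
  proof (rule nth_equalityI)
    fix j assume "j < length w"
    then have j: "j < 2 * n - 2"
      by (simp add: length_w)
    consider m where "j = 2 * m" "m + 2 < n" | "j = 2 * (n - 2)" | "j = 1"
      | m where "j = 2 * m + 3" "m + 2 < n"
    proof (cases "even j")
      case True
      then obtain m where "j = 2 * m" ..
      then show ?thesis
        using that(1)[of m] that(2) j by (cases "m + 2 < n") auto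
    next
      case False
      then obtain m where "j = 2 * m + 1" ..
      then show ?thesis
        using that(3) that(4)[of "m - 1"] j by (cases m) auto
    qed
    then show "w ! j = zigzag n ! j"
      using j n by cases (auto simp: nth_zigzag even odd first[unfolded One_nat_def] last)
  qed (simp add: length_w)
qed

lemma zigzag_cases: "w = zigzag n \<or> rev w = zigzag n"
proof -
  obtain a where a: "occ w 1 = {a, a + 3}" "a + 3 < length w"
    using window[of 1] n by auto
  have "occ w 2 = {a + 2, a + 5} \<or> (\<exists>c. a = c + 2 \<and> occ w 2 = {c, c + 3})"
    using consecutive_windows[of 1 a] a n by (simp add: numeral_2_eq_2)
  then show ?thesis
  proof (elim disjE exE conjE)
    assume "occ w 2 = {a + 2, a + 5}"
    then show ?thesis
      using zigzag_if_increasing a by simp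
  next
    fix c assume c: "a = c + 2" "occ w 2 = {c, c + 3}"
    interpret rev: cycle_word n "rev w"
      by (rule rev_cycle_word)
    \<comment> \<open>The second copy of \<open>1\<close> is at \<open>c + 5\<close>;
      \<open>d\<close> is its position in the reversed word, hence the first position of
      \<open>1\<close> there. Reversal turns the leftward move into a rightward one.\<close>
    define d where "d = length w - (c + 6)"
    have d: "length w = c + d + 6"
      using a(2) c(1) by (simp add: d_def)
    have "occ (rev w) 1 = {d, d + 3}" "occ (rev w) 2 = {d + 2, d + 5}"
      using a c d by (auto simp: occ_rev)
    then show ?thesis
      using rev.zigzag_if_increasing by simp
  qed
qed

end

section \<open>Counting the words of minimum length\<close>

lemma minimal_word_cases:
  assumes n: "n \<ge> 4" and w: "word_represents w (cycle_graph n)" "length w = 2 * n - 2"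
  shows "\<exists>k < n. w = map (rot n k) (zigzag n) \<or> rev w = map (rot n k) (zigzag n)"
proof -
  have set: "set w = {..<n}"
    using w by (simp add: word_represents_def)
  obtain u v where uv: "v = Suc u mod n" "u < n" "count_list w u = 1" "count_list w v = 1"
    and inner: "\<And>x. x < n \<Longrightarrow> x \<noteq> u \<Longrightarrow> x \<noteq> v \<Longrightarrow> count_list w x = 2"
    using cycle_word_multiplicities(2)[OF n w] by blast
  have v: "v < n"
    using uv n by simp
  \<comment> \<open>This rotation sends \<open>v\<close> to \<open>0\<close> and its predecessor
    \<open>u\<close> to \<open>n - 1\<close>, as \<open>cycle_word\<close> requires;
    \<open>rot n v\<close> undoes it.\<close>
  define r where "r = rot n (n - v)"
  have r_inj: "inj_on r {..<n}"
    using bij_betw_rot[of "n - v" n] by (simp add: r_def bij_betw_def)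
  have count_r: "count_list (map r w) (r x) = count_list w x" if "x < n" for x
    using count_list_inj_map[of r w x] r_inj that set by simp
  have rv: "r v = 0"
    using v by (simp add: r_def rot_def)
  have ru: "r u = n - 1"
    using uv by (cases "Suc u = n") (auto simp: r_def rot_def)
  interpret cycle_word n "map r w"
  proof
    show "n \<ge> 4"
      by (rule n)
    show "word_represents (map r w) (cycle_graph n)"
      unfolding r_def using w by (intro word_represents_rot) auto
    show "count_list (map r w) 0 = 1" "count_list (map r w) (n - 1) = 1"
      using count_r[of v] count_r[of u] uv v rv ru by auto
    fix x assume x: "0 < x" "Suc x < n"
    have "x = r (rot n v x)"
      using rot_rot_inverse(2)[of x n v] x v by (simp add: r_def)
    moreover from this have "rot n v x \<noteq> u" "rot n v x \<noteq> v"
      using rv ru x by auto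
    moreover have "rot n v x < n"
      using x by (simp add: rot_less)
    ultimately show "count_list (map r w) x = 2"
      using count_r[of "rot n v x"] inner[of "rot n v x"] by simp
  qed
  have "rot n v (r x) = x" if "x \<in> set w" for x
    using that set v by (simp add: r_def rot_rot_inverse)
  then have w_eq: "map (rot n v) (map r w) = w"
    by (simp add: map_idI)
  have "map (rot n v) (rev (map r w)) = rev w"
    using arg_cong[OF w_eq, of rev] by (simp only: rev_map)
  with w_eq have "w = map (rot n v) (zigzag n) \<or> rev w = map (rot n v) (zigzag n)"
    using zigzag_cases by metis
  then show ?thesis
    using v by blast
qed

lemma min_word_length_cycle: "n \<ge> 4 \<Longrightarrow> min_word_length (cycle_graph n) = 2 * n - 2"
  unfolding min_word_length_def using word_represents_zigzag cycle_word_multiplicities(1)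
  by (intro Least_equality) (auto intro!: exI[of _ "zigzag n"])

text \<open>The minimal words are the \<open>n\<close> rotations of the zigzag and their reversals;
  it remains to see that these \<open>2 * n\<close> words are distinct.\<close>

lemma num_min_words_cycle:
  assumes n: "n \<ge> 4"
  shows "num_min_words (cycle_graph n) = 2 * n"
proof -
  define W where "W k = map (rot n k) (zigzag n)" for k
  have rep: "word_represents (W k) (cycle_graph n)" if "k < n" for k
    unfolding W_def using that n by (intro word_represents_rot word_represents_zigzag) auto
  have len: "length (W k) = 2 * n - 2" for k
    by (simp add: W_def)
  have "{w. word_represents w (cycle_graph n) \<and> length w = 2 * n - 2} = W ` {..<n} \<union> (rev \<circ> W) ` {..<n}"
  proof (intro equalityI subsetI)
    fix w assume "w \<in> {w. word_represents w (cycle_graph n) \<and> length w = 2 * n - 2}"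
    then obtain k where "k < n" "w = W k \<or> rev w = W k"
      using minimal_word_cases[OF n] unfolding W_def by blast
    then show "w \<in> W ` {..<n} \<union> (rev \<circ> W) ` {..<n}"
      by (metis UnI1 UnI2 comp_apply image_eqI lessThan_iff rev_rev_ident)
  qed (auto simp: rep len word_represents_rev)
  \<comment> \<open>Position 1 of the zigzag holds \<open>0\<close>, so the shift can be read off
    there.\<close>
  moreover have W1: "W k ! 1 = k" if "k < n" for k
    using that n by (simp add: W_def nth_zigzag rot_def)
  have inj: "inj_on W {..<n}"
    using W1 by (intro inj_onI) (metis lessThan_iff)
  moreover have inj_rev: "inj_on (rev \<circ> W) {..<n}"
    using inj by (intro comp_inj_on) auto
  moreover have "W ` {..<n} \<inter> (rev \<circ> W) ` {..<n} = {}"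
  proof -
    have False if kl: "k < n" "l < n" "W k = rev (W l)" for k l
    proof -
      obtain m where m: "n = m + 4"
        using n by (metis add.commute le_Suc_ex)
      have k: "W k ! 0 = Suc k mod n"
        using n by (simp add: W_def nth_zigzag rot_def)
      have l: "rev (W l) ! 0 = (m + 2 + l) mod n" "rev (W l) ! 1 = Suc (m + 2 + l) mod n"
        using m by (auto simp: rev_nth len W_def nth_zigzag rot_def)
      \<comment> \<open>Modulo \<open>n\<close>, a rotated zigzag begins with a descent by one and a
        reversed one with an ascent by one. Equality would give \<open>k = k + 2\<close> modulo
        \<open>n\<close>.\<close>
      have "Suc k mod n = (m + 2 + l) mod n" "k = Suc (m + 2 + l) mod n"
        using k l W1[OF kl(1)] by (simp_all only: kl(3))
      then have "k = Suc (Suc k) mod n"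
        by (metis mod_Suc_eq)
      then show False
        using kl n by (auto simp: mod_Suc split: if_splits)
    qed
    then show ?thesis
      by auto
  qed
  ultimately show ?thesis
    unfolding num_min_words_def min_word_length_cycle[OF n]
    by (simp add: card_Un_disjoint card_image del: o_apply)
qed

section \<open>The triangle\<close>

text \<open>All three pairs are edges, so every pair has to alternate, which is automatic if no
  letter repeats. Length 3 with three letters forces exactly this, and the count becomes
  \<open>3! = 6\<close>.\<close>

lemma word_represents_triangle_iff:
  "word_represents w (cycle_graph 3) \<and> length w = 3 \<longleftrightarrow> w \<in> permutations_of_set {..<3}"
proof -
  have edge: "{x, y} \<in> snd (cycle_graph 3)" if "x < 3" "y < 3" "x \<noteq> y" for x y
    using that by (auto simp: cycle_edge_iff mod_Suc split: if_splits)
  have alt: "alternate w x y" if "distinct w" for x y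
    using that by (intro alternate_if_count_le_1 count_list_le_1_if_distinct)
  have "distinct w \<longleftrightarrow> length w = 3" if "set w = {..<3}"
    using that card_distinct[of w] distinct_card[of w] by auto
  then show ?thesis
    using edge alt by (auto simp: word_represents_def permutations_of_set_def)
qed

lemma num_min_words_triangle: "num_min_words (cycle_graph 3) = 6"
proof -
  have "permutations_of_set {..<3::nat} \<noteq> {}"
    by simp
  then obtain w where "word_represents w (cycle_graph 3)" "length w = 3"
    using word_represents_triangle_iff by blast
  moreover have "3 \<le> length w" if "word_represents w (cycle_graph 3)" for w
    using that card_length[of w] by (simp add: word_represents_def)
  ultimately have "min_word_length (cycle_graph 3) = 3"
    unfolding min_word_length_def by (intro Least_equality) auto
  then show ?thesis
    by (simp add: num_min_words_def word_represents_triangle_iff fact_numeral)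
qed

theorem theorem6:
  fixes n :: nat
  assumes "n \<ge> 3"
  shows "num_min_words (cycle_graph n) = 2 * n"
  using assms num_min_words_cycle[of n] num_min_words_triangle by (cases "n = 3") auto

end
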